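(* Let $(P,\ell,\mathcal F)$ be a learning problem and let $\Pi_|$ be an arbitrary learning algorithm based on $\mathcal F$. Assume that $(P,\ell,\mathcal F)$ satisfies the $(u,c)$-witness condition. Then under the $v$-central condition, for any $\epsilon\ge0$ and any $0<\eta<v(\epsilon)$, $$\mathbf E_{f\sim\Pi_n}\big[\mathbf E[L_f]\big]\ \trianglelefteq_{\frac{\eta\cdot n}{c_{u+\epsilon}}}\ c_{u+\epsilon}\cdot\big(\mathrm{IC}_{n,\eta}(\Pi_|)+\epsilon\big),$$ where $c_{x}:=\frac1c\,\frac{\eta x+1}{1-\eta/v(\epsilon)}$ for $x>0$.
   Context: Learning problem $(P,\ell,\mathcal F)$: $P$ is a probability distribution on a measurable sample space $\mathcal Z$; $\mathcal F$ is a set (the model); $\ell:\mathcal F\times\mathcal Z\to\mathbb R\cup\{\infty\}$ is a loss, $\ell_f(z):=\ell(f,z)$; $\ell_f$ also denotes the random variable $\ell_f(Z)$ with $Z\sim P$; $\mathbf E$ is expectation under $P$. Standing assumptions: (1) unless $\ell$ is (conditional) log loss, $\inf_{f\in\mathcal F}\inf_{z\in\mathcal Z}\ell_f(z)>-\infty$; (2) if $\ell$ is (conditional) log loss $\ell_f=-\log p_f$, all $p_f$ are probability densities relative to a common dominating measure $\mu$, $P\ll\mu$, $\mathrm{KL}(P\|P_{f^*})<\infty$ and the differential entropy of $P$ relative to $\mu$ is $>-\infty$; (3) $\mathbf E[\ell_f]<\infty$ for some $f\in\mathcal F$; (4) there is an optimal $f^*\in\mathcal F$, i.e. $\mathbf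 E[\ell_f-\ell_{f^*}]\ge 0$ for all $f\in\mathcal F$; one such $f^*$ is fixed. Excess loss: $L_f:=\ell_f-\ell_{f^*}$. Learning algorithm $\Pi_|$: a function mapping each sample $z^n\in\mathcal Z^n$, $n=0,1,2,\dots$, to a probability distribution on $\mathcal F$. $\Pi_n$ denotes the output on $Z^n=(Z_1,\dots,Z_n)$, with $Z_1,\dots,Z_n$ i.i.d. $\sim P$; $\Pi_0$ (output on the empty sample) is called the prior. It is assumed that $\Pi_n$ always has a density relative to $\Pi_0$ and that $\Pi_0(\{f:\ell_f(z)<\infty\})>0$ for all $z\in\mathcal Z$. In $\mathbf E_{f\sim\Pi_n}[\mathbf E[L_f]]$ the inner expectation is over a fresh $Z\sim P$ independent of $Z^n$. Information complexity (a random variable depending on $Z^n$): $\mathrm{IC}_{n,\eta}(\Pi_|):=\mathbf E_{f\sim\Pi_n}\big[\frac1n\sum_{i=1}^n L_f(Z_i)\big]+\frac{\mathrm{KL}(\Pi_n\|\Pi_0)}{\eta\cdot n}$. Exponential stochastic inequality (ESI): for $a>0$, $U\trianglelefteq_a U'$ means $\mathbf E[e^{a(U-U')}]\le1$ (in the claim the expectation is over $Z^n\sim P^n$). $(u,c)$-witness condition, for constants $u>0$ and $c\in(0,1]$: for all $f\in\mathcal F$, $\mathbf E[L_f\cdot\mathbf 1_{\{L_f\le u\}}]\ge c\,\mathbf E[L_f]$. $v$-central condition: $v:[0,\infty)\to[0,\infty)$ is a bounded, non-decreasing function with $v(\epsilon)>0$ for all $\epsilon>0$, and for all $\epsilon\ge0$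 there exists a function $\tilde f\in\mathcal F$ (possibly depending on $\epsilon$) such that $\mathbf E\big[e^{v(\epsilon)(\ell_{\tilde f}-\ell_f-\epsilon)}\big]\le1$ for all $f\in\mathcal F$.
   Formalization: The formal theorem additionally assumes that, at the ε of the claim, the fixed optimal f* itself can serve as the comparator f̃ in the v-central condition; with f̃ allowed to differ from f* the claim as stated is false. *)

theory Defs
  imports "HOL-Probability.Probability"
begin

text \<open>Expectation of an extended-real random variable. Unlike the Bochner integral it does not
  default to 0 for non-integrable arguments; if positive and negative part both have infinite
  integral, the value is \<open>\<infinity> - \<infinity> = \<infinity>\<close> (the convention of \<^typ>\<open>ereal\<close>).\<close>

definition ereal_expectation :: "'a measure \<Rightarrow> ('a \<Rightarrow> ereal) \<Rightarrow> ereal" where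
  "ereal_expectation M X =
     enn2ereal (\<integral>\<^sup>+ x. e2ennreal (max 0 (X x)) \<partial>M) - enn2ereal (\<integral>\<^sup>+ x. e2ennreal (max 0 (- X x)) \<partial>M)"

definition exp_ereal :: "ereal \<Rightarrow> ennreal" where
  "exp_ereal x = (if x = \<infinity> then \<infinity> else if x = -\<infinity> then 0 else ennreal (exp (real_of_ereal x)))"

text \<open>\<open>KL(N \<parallel> M)\<close> with value \<open>\<infinity>\<close> allowed. The library's \<^const>\<open>KL_divergence\<close> is real-valued and
  returns 0 when the log-density is not integrable, so only \<^const>\<open>entropy_density\<close>
  (the logarithm of the Radon-Nikodym derivative \<open>dN/dM\<close>) is taken from it.\<close>

definition KL :: "'a measure \<Rightarrow> 'a measure \<Rightarrow> ereal" where
  "KL N M = (if absolutely_continuous M N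
     then ereal_expectation N (\<lambda>x. ereal (entropy_density (exp 1) M N x)) else \<infinity>)"

text \<open>Differential entropy of \<open>P\<close> relative to \<open>\<mu>\<close>, for \<open>P \<lless> \<mu>\<close>. With the convention for
  \<^const>\<open>ereal_expectation\<close> it exceeds \<open>-\<infinity>\<close> exactly if the positive part of \<open>log (dP/d\<mu>)\<close>
  is \<open>P\<close>-integrable.\<close>

definition differential_entropy :: "'a measure \<Rightarrow> 'a measure \<Rightarrow> ereal" where
  "differential_entropy \<mu> P = - ereal_expectation P (\<lambda>z. ereal (entropy_density (exp 1) \<mu> P z))"

definition neg_log :: "real \<Rightarrow> ereal" where
  "neg_log x = (if x = 0 then \<infinity> else ereal (- ln x))"

text \<open>Log loss with its regularity conditions. Conditional log loss \<open>- log p\<^sub>f(y | x)\<close>, with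
  conditional densities relative to \<open>\<mu>\<^sub>Y\<close>, is the instance where \<open>\<mu>\<close> is the product of the
  \<open>X\<close>-marginal of \<open>P\<close> and \<open>\<mu>\<^sub>Y\<close>: relative to it \<open>(x, y) \<mapsto> p\<^sub>f(y | x)\<close> is a joint density.\<close>

definition log_loss_setting ::
  "'z measure \<Rightarrow> 'f measure \<Rightarrow> ('f \<Rightarrow> 'z \<Rightarrow> ereal) \<Rightarrow> 'f \<Rightarrow> bool" where
  "log_loss_setting P F l fstar \<longleftrightarrow>
     (\<exists>(\<mu> :: 'z measure) (p :: 'f \<Rightarrow> 'z \<Rightarrow> real).
        sigma_finite_measure \<mu> \<and> sets \<mu> = sets P \<and>
        (\<forall>f\<in>space F. p f \<in> borel_measurable \<mu> \<and> (\<forall>z\<in>space \<mu>. 0 \<le> p f z) \<and>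
           (\<integral>\<^sup>+ z. ennreal (p f z) \<partial>\<mu>) = 1 \<and> (\<forall>z\<in>space \<mu>. l f z = neg_log (p f z))) \<and>
        absolutely_continuous \<mu> P \<and>
        KL P (density \<mu> (\<lambda>z. ennreal (p fstar z))) < \<infinity> \<and>
        differential_entropy \<mu> P > -\<infinity>)"

definition excess_loss :: "('f \<Rightarrow> 'z \<Rightarrow> ereal) \<Rightarrow> 'f \<Rightarrow> 'f \<Rightarrow> 'z \<Rightarrow> ereal" where
  "excess_loss l fstar f z = l f z - l fstar z"

text \<open>The model is the set \<^term>\<open>space F\<close>; the measure \<^term>\<open>F\<close> only carries the \<open>\<sigma>\<close>-algebra on
  which distributions over the model live, its own weights are irrelevant.\<close>

locale learning_problem = prob_space P for P :: "'z measure" +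
  fixes F :: "'f measure" and l :: "'f \<Rightarrow> 'z \<Rightarrow> ereal" and fstar :: 'f
  assumes loss_measurable: "(\<lambda>(f, z). l f z) \<in> borel_measurable (F \<Otimes>\<^sub>M P)"
    and loss_not_MInf: "\<And>f z. f \<in> space F \<Longrightarrow> z \<in> space P \<Longrightarrow> l f z \<noteq> -\<infinity>"
    and bounded_below_or_log_loss:
      "(INF f\<in>space F. INF z\<in>space P. l f z) > -\<infinity> \<or> log_loss_setting P F l fstar"
    and finite_risk: "\<exists>f\<in>space F. ereal_expectation P (l f) < \<infinity>"
    and fstar_in_model: "fstar \<in> space F"
    and fstar_optimal: "\<And>f. f \<in> space F \<Longrightarrow> ereal_expectation P (excess_loss l fstar f) \<ge> 0"

text \<open>A learning algorithm maps every finite sample, given as a list, to a distribution on the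
  model; the prior is its value on the empty list. No measurability in the sample is required.\<close>

definition learning_algorithm ::
  "'z measure \<Rightarrow> 'f measure \<Rightarrow> ('f \<Rightarrow> 'z \<Rightarrow> ereal) \<Rightarrow> ('z list \<Rightarrow> 'f measure) \<Rightarrow> bool" where
  "learning_algorithm P F l Q \<longleftrightarrow>
     (\<forall>zs\<in>lists (space P). prob_space (Q zs) \<and> sets (Q zs) = sets F \<and>
        (\<exists>g\<in>borel_measurable F. Q zs = density (Q []) g)) \<and>
     (\<forall>z\<in>space P. emeasure (Q []) {f \<in> space F. l f z < \<infinity>} > 0)"

definition sample :: "nat \<Rightarrow> (nat \<Rightarrow> 'z) \<Rightarrow> 'z list" where
  "sample n z = map z [0..<n]"

definition information_complexity ::
  "('f \<Rightarrow> 'z \<Rightarrow> ereal) \<Rightarrow> 'f \<Rightarrow> ('z list \<Rightarrow> 'f measure) \<Rightarrow> nat \<Rightarrow> real \<Rightarrow> (nat \<Rightarrow> 'z) \<Rightarrow> ereal" where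
  "information_complexity l fstar Q n \<eta> z =
     ereal_expectation (Q (sample n z)) (\<lambda>f. (\<Sum>i<n. excess_loss l fstar f (z i)) / ereal (real n)) +
     KL (Q (sample n z)) (Q []) / ereal (\<eta> * real n)"

text \<open>\<open>U \<unlhd>\<^sub>a U'\<close> for extended-real random variables on \<open>M\<close>. At outcomes with \<open>U' = \<infinity>\<close> the bound
  on \<open>U\<close> is void and the integrand is 0; this only fixes the undefined case \<open>U = U' = \<infinity>\<close>,
  since \<^typ>\<open>ereal\<close> subtraction would give \<open>\<infinity> - \<infinity> = \<infinity>\<close> there.\<close>

definition esi :: "'a measure \<Rightarrow> real \<Rightarrow> ('a \<Rightarrow> ereal) \<Rightarrow> ('a \<Rightarrow> ereal) \<Rightarrow> bool" where
  "esi M a U U' \<longleftrightarrow>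
     (\<integral>\<^sup>+ \<omega>. exp_ereal (ereal a * (if U' \<omega> = \<infinity> then -\<infinity> else U \<omega> - U' \<omega>)) \<partial>M) \<le> 1"

definition witness_condition ::
  "'z measure \<Rightarrow> 'f measure \<Rightarrow> ('f \<Rightarrow> 'z \<Rightarrow> ereal) \<Rightarrow> 'f \<Rightarrow> real \<Rightarrow> real \<Rightarrow> bool" where
  "witness_condition P F l fstar u c \<longleftrightarrow> u > 0 \<and> 0 < c \<and> c \<le> 1 \<and>
     (\<forall>f\<in>space F.
        ereal_expectation P (\<lambda>z. if excess_loss l fstar f z \<le> ereal u then excess_loss l fstar f z else 0)
          \<ge> ereal c * ereal_expectation P (excess_loss l fstar f))"

text \<open>The \<open>a\<close>-central condition up to \<open>\<epsilon>\<close> with comparator \<open>g\<close>.\<close>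

definition central_up_to ::
  "'z measure \<Rightarrow> 'f measure \<Rightarrow> ('f \<Rightarrow> 'z \<Rightarrow> ereal) \<Rightarrow> 'f \<Rightarrow> real \<Rightarrow> real \<Rightarrow> bool" where
  "central_up_to P F l g a \<epsilon> \<longleftrightarrow> g \<in> space F \<and>
     (\<forall>f\<in>space F. (\<integral>\<^sup>+ z. exp_ereal (ereal a * (l g z - l f z - ereal \<epsilon>)) \<partial>P) \<le> 1)"

text \<open>The comparator may vary with \<open>\<epsilon>\<close> and need not be the fixed optimal element \<open>fstar\<close> relative
  to which excess losses are formed. An exponential bound on excess losses at level \<open>\<epsilon>\<close> needs
  in addition that \<open>fstar\<close> itself is an admissible comparator at that \<open>\<epsilon>\<close>: otherwise
  \<open>l fstar - l f\<close> can have arbitrarily large exponential moments for some \<open>f\<close>.\<close>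

definition v_central ::
  "'z measure \<Rightarrow> 'f measure \<Rightarrow> ('f \<Rightarrow> 'z \<Rightarrow> ereal) \<Rightarrow> (real \<Rightarrow> real) \<Rightarrow> bool" where
  "v_central P F l v \<longleftrightarrow>
     (\<forall>\<epsilon>\<ge>0. v \<epsilon> \<ge> 0) \<and> bounded (v ` {0..}) \<and> mono_on {0..} v \<and> (\<forall>\<epsilon>>0. v \<epsilon> > 0) \<and>
     (\<forall>\<epsilon>\<ge>0. \<exists>g. central_up_to P F l g (v \<epsilon>) \<epsilon>)"

text \<open>The constant \<open>c\<^sub>x\<close>, with \<open>w\<close> standing for \<open>v(\<epsilon>)\<close>.\<close>

definition witness_const :: "real \<Rightarrow> real \<Rightarrow> real \<Rightarrow> real \<Rightarrow> real" where
  "witness_const c \<eta> w x = 1 / c * ((\<eta> * x + 1) / (1 - \<eta> / w))"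

end

theory Submission
  imports Defs
begin

text \<open>
  For a single \<open>f\<close>, a pointwise inequality bounds \<open>x 1{x \<le> u}\<close> by a combination of
  \<open>1 - e\<^bsup>-\<eta>x\<^esup>\<close> and \<open>e\<^bsup>-wx\<^esup> - 1\<close> with nonnegative coefficients. Taking expectations
  at \<open>x = L\<^sub>f + \<epsilon>\<close> with \<open>w = v(\<epsilon>)\<close>, the central condition discards the second term, the witness
  condition turns the left-hand side into \<open>c E[L\<^sub>f]\<close>, and \<open>1 - y \<le> - ln y\<close> yields
  \<open>(\<eta> / C) E[L\<^sub>f] - \<eta> \<epsilon> \<le> - ln E[e\<^bsup>-\<eta>L\<^esup>]\<close> with \<open>C = c\<^bsub>u+\<epsilon>\<^esub>\<close>. The change of measure
  of Donsker and Varadhan then bounds the exponential in the claim, for each sample, by the prior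
  average of \<open>\<Prod>\<^sub>i e\<^bsup>-\<eta>L(Z\<^sub>i)\<^esup> / E[e\<^bsup>-\<eta>L\<^esup>]\<close>, whose expectation over the sample is 1.
\<close>

section \<open>A pointwise inequality between a truncated variable and two exponentials\<close>

text \<open>The difference vanishes at 0, and its derivative
  \<open>exp (- s * x) - exp (- t * x)\<close> has the sign of \<open>x\<close>, so 0 is its
  minimum.\<close>

lemma scaled_exp_diff_nonneg:
  fixes s t x :: real
  assumes "0 < s" "s < t"
  shows "(1 - exp (- t * x)) / t \<le> (1 - exp (- s * x)) / s"
proof -
  define D where "D y = (1 - exp (- s * y)) / s - (1 - exp (- t * y)) / t" for y
  have der: "(D has_real_derivative exp (- s * y) - exp (- t * y)) (at y)" for y
    unfolding D_def using assms by (auto intro!: derivative_eq_intros simp: field_simps)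
  have "D 0 \<le> D x"
  proof (cases "0 \<le> x")
    case True
    show ?thesis
      by (rule DERIV_nonneg_imp_nondecreasing[OF True])
         (use der assms in \<open>auto intro!: exI mult_right_mono\<close>)
  next
    case False
    then have "x \<le> 0" by simp
    show ?thesis
      by (rule DERIV_nonpos_imp_nonincreasing[OF \<open>x \<le> 0\<close>])
         (use der assms in \<open>auto intro!: exI mult_right_mono_neg\<close>)
  qed
  then show ?thesis by (simp add: D_def)
qed

text \<open>The coefficient \<open>(a - 1) / t\<close> makes both sides agree to first order at \<open>x = 0\<close>.\<close>

lemma truncated_le_exp_combination:
  fixes s t u x :: real
  assumes st: "0 < s" "s < t" and u: "0 \<le> u" and a: "a = (s * u + 1) / (1 - s / t)"
  shows "(if x \<le> u then x else 0) \<le> a / s * (1 - exp (- s * x)) + (a - 1) / t * (exp (- t * x) - 1)"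
proof -
  define r where "r = 1 - s / t"
  have r: "0 < r" "r \<le> 1" using st by (auto simp: r_def field_simps)
  define D where "D y = (1 - exp (- s * y)) / s - (1 - exp (- t * y)) / t" for y
  define E where "E y = (1 - exp (- t * y)) / t" for y
  have D0: "0 \<le> D y" for y
    using scaled_exp_diff_nonneg[OF st] by (simp add: D_def)
  have dE: "(E has_real_derivative exp (- t * y)) (at y)" for y
    unfolding E_def using st by (auto intro!: derivative_eq_intros simp: field_simps)
  have dD: "(D has_real_derivative exp (- s * y) - exp (- t * y)) (at y)" for y
    unfolding D_def using st by (auto intro!: derivative_eq_intros simp: field_simps)
  have rhs: "a / s * (1 - exp (- s * x)) + (a - 1) / t * (exp (- t * x) - 1) = a * D x + E x"
    using st by (simp add: D_def E_def field_simps)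
  \<comment> \<open>\<open>a\<close> is the value at \<open>u\<close> of a function increasing in
    its argument. As \<open>D\<close> is nonnegative, \<open>a\<close> may be lowered to the value
    at \<open>x\<close> or at 0, which removes \<open>u\<close> from the inequality.\<close>
  have a1: "(s * y + 1) / r \<le> a" if "y \<le> u" for y
    unfolding a r_def[symmetric] using that st r by (intro divide_right_mono) auto
  have a0: "0 \<le> a" using u st r by (simp add: a r_def[symmetric])
  consider "u < x" | "0 \<le> x" "x \<le> u" | "x < 0" by linarith
  then show ?thesis
  proof cases
    case 1
    then have "0 \<le> E x" using u st by (auto simp: E_def)
    then show ?thesis using 1 a0 D0[of x] unfolding rhs by simp
  next
    case 2
    \<comment> \<open>After lowering \<open>a\<close> to its value at \<open>x\<close> and
      multiplying by \<open>r\<close>, nonnegativity of \<open>g x\<close> remains. The derivative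
      of \<open>g\<close> collapses to \<open>s * y\<close> times that of \<open>D\<close>.\<close>
    define g where "g y = (s * y + 1) * D y - r * (y - E y)" for y
    have "(g has_real_derivative s * y * (exp (- s * y) - exp (- t * y))) (at y)" for y
      unfolding g_def
      by (rule derivative_eq_intros dD dE refl)+
         (use st in \<open>simp add: D_def r_def field_simps\<close>)
    moreover have "0 \<le> s * y * (exp (- s * y) - exp (- t * y))" if "0 \<le> y" for y
      using that st by (intro mult_nonneg_nonneg) (auto intro!: mult_right_mono)
    ultimately have "g 0 \<le> g x"
      by (intro DERIV_nonneg_imp_nondecreasing[OF 2(1)]) blast
    then have "x \<le> (s * x + 1) / r * D x + E x"
      using r by (simp add: g_def D_def E_def field_simps)
    also have "\<dots> \<le> a * D x + E x"
      using a1[OF 2(2)] D0 by (intro add_right_mono mult_right_mono) auto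
    finally show ?thesis using 2 unfolding rhs by simp
  next
    case 3
    \<comment> \<open>Here the value \<open>1 / r\<close> of the coefficient at 0 suffices. The
      function \<open>g\<close> decreases because exp is convex and \<open>- s * y\<close> lies
      between 0 and \<open>- t * y\<close> with weight \<open>s / t\<close>.\<close>
    define g where "g y = D y + r * (E y - y)" for y
    have dg: "(g has_real_derivative exp (- s * y) - exp (- t * y) + r * (exp (- t * y) - 1)) (at y)" for y
      unfolding g_def by (rule derivative_eq_intros dD dE refl)+ simp
    have "exp (- s * y) - exp (- t * y) + r * (exp (- t * y) - 1) \<le> 0" for y
    proof -
      have "(1 - s / t) *\<^sub>R 0 + (s / t) *\<^sub>R (- t * y) = - s * y" using st by simp
      moreover have "exp ((1 - s / t) *\<^sub>R 0 + (s / t) *\<^sub>R (- t * y)) \<le> (1 - s / t) * exp 0 + (s / t) * exp (- t * y)"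
        using st by (intro convex_onD[OF exp_convex]) (auto simp: field_simps)
      ultimately show ?thesis by (simp add: r_def algebra_simps)
    qed
    then have "g 0 \<le> g x"
      using 3 dg by (intro DERIV_nonpos_imp_nonincreasing[of x 0 g]) (auto intro!: exI)
    then have "x \<le> 1 / r * D x + E x"
      using r by (simp add: g_def D_def E_def field_simps)
    also have "\<dots> \<le> a * D x + E x"
      using a1[of 0] u D0 by (intro add_right_mono mult_right_mono) auto
    finally show ?thesis using 3 u unfolding rhs by simp
  qed
qed

section \<open>The bound for a single predictor\<close>

text \<open>\<open>L\<close> plays the role of a real-valued version of the excess loss of one
  \<open>f\<close>. The bound ends in a logarithm so that n copies of it add up to the logarithm of
  a product over the sample.\<close>

lemma (in prob_space) witness_annealed_bound:
  fixes L :: "'a \<Rightarrow> real"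
  assumes \<eta>: "0 < \<eta>" "\<eta> < w" and "0 \<le> \<epsilon>" "0 < u" "0 < c"
    and L: "integrable M L"
    and exp_int: "integrable M (\<lambda>z. exp (- w * (L z + \<epsilon>)))"
    and central: "expectation (\<lambda>z. exp (- w * (L z + \<epsilon>))) \<le> 1"
    and witness: "c * expectation L \<le> expectation (\<lambda>z. if L z \<le> u then L z else 0)"
  shows "integrable M (\<lambda>z. exp (- \<eta> * L z))"
    and "0 < expectation (\<lambda>z. exp (- \<eta> * L z))"
    and "\<eta> / witness_const c \<eta> w (u + \<epsilon>) * expectation L - \<eta> * \<epsilon>
           \<le> - ln (expectation (\<lambda>z. exp (- \<eta> * L z)))"
proof -
  have [measurable]: "L \<in> borel_measurable M" using L by auto
  \<comment> \<open>\<open>exp (- \<eta> * y)\<close> is at most 1 for nonnegative y and at most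
    \<open>exp (- w * y)\<close> for negative y, so the moment of order \<open>w\<close> controls
    the one of order \<open>\<eta>\<close>.\<close>
  have int: "integrable M (\<lambda>z. exp (- \<eta> * (L z + \<epsilon>)))"
  proof (rule Bochner_Integration.integrable_bound)
    show "integrable M (\<lambda>z. 1 + exp (- w * (L z + \<epsilon>)))" using exp_int by auto
    have "exp (- \<eta> * y) \<le> 1 + exp (- w * y)" for y
    proof (cases "0 \<le> y")
      case True
      then have "exp (- \<eta> * y) \<le> 1" using \<eta> by simp
      then show ?thesis by (rule order_trans) simp
    next
      case False
      then have "exp (- \<eta> * y) \<le> exp (- w * y)"
        using \<eta> by (auto intro!: mult_right_mono_neg)
      then show ?thesis by linarith
    qed
    then show "AE z in M. norm (exp (- \<eta> * (L z + \<epsilon>))) \<le> norm (1 + exp (- w * (L z + \<epsilon>)))"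
      by (intro AE_I2) (metis abs_ge_self abs_exp_cancel order_trans real_norm_def)
  qed measurable
  have split: "exp (- \<eta> * L z) = exp (\<eta> * \<epsilon>) * exp (- \<eta> * (L z + \<epsilon>))" for z
    by (simp add: exp_add[symmetric] algebra_simps)
  show int': "integrable M (\<lambda>z. exp (- \<eta> * L z))"
    unfolding split using int by simp
  let ?m = "expectation (\<lambda>z. exp (- \<eta> * L z))"
  show m: "0 < ?m"
  proof -
    have "?m \<noteq> 0"
    proof
      assume "?m = 0"
      then have "AE z in M. exp (- \<eta> * L z) = 0"
        using int' by (subst (asm) integral_nonneg_eq_0_iff_AE) auto
      then show False using AE_False by simp
    qed
    moreover have "0 \<le> ?m" by (intro integral_nonneg_AE) auto
    ultimately show ?thesis by linarith
  qed
  define a where "a = (\<eta> * (u + \<epsilon>) + 1) / (1 - \<eta> / w)"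
  \<comment> \<open>This makes \<open>(a - 1) / w\<close> nonnegative, so that the central condition
    allows the second exponential term to be dropped.\<close>
  have "1 \<le> a" using \<eta> assms(3,4) by (simp add: a_def field_simps add_increasing)
  let ?X = "\<lambda>z. L z + \<epsilon>"
  have iw: "integrable M (\<lambda>z. if L z \<le> u then L z else 0)"
    by (rule Bochner_Integration.integrable_bound[OF L]) auto
  have "c * expectation L \<le> expectation (\<lambda>z. if L z \<le> u then L z else 0)"
    by (rule witness)
  also have "\<dots> \<le> expectation (\<lambda>z. a / \<eta> * (1 - exp (- \<eta> * ?X z)) + (a - 1) / w * (exp (- w * ?X z) - 1))"
  proof (rule integral_mono[OF iw])
    fix z
    \<comment> \<open>Shifting variable and threshold by the same \<open>\<epsilon>\<close> keeps
      the truncation event, and \<open>0 \<le> \<epsilon>\<close> makes the value no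
      smaller.\<close>
    have "(if L z \<le> u then L z else 0) \<le> (if ?X z \<le> u + \<epsilon> then ?X z else 0)"
      using assms(3) by auto
    also have "\<dots> \<le> a / \<eta> * (1 - exp (- \<eta> * ?X z)) + (a - 1) / w * (exp (- w * ?X z) - 1)"
      using assms by (intro truncated_le_exp_combination) (auto simp: a_def)
    finally show "(if L z \<le> u then L z else 0) \<le> a / \<eta> * (1 - exp (- \<eta> * ?X z)) + (a - 1) / w * (exp (- w * ?X z) - 1)" .
  qed (use int exp_int in auto)
  also have "\<dots> = a / \<eta> * (1 - expectation (\<lambda>z. exp (- \<eta> * ?X z))) + (a - 1) / w * (expectation (\<lambda>z. exp (- w * ?X z)) - 1)"
    using int exp_int by (simp add: prob_space)
  also have "\<dots> \<le> a / \<eta> * (1 - expectation (\<lambda>z. exp (- \<eta> * ?X z)))"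
    using central \<open>1 \<le> a\<close> \<eta> by (simp only: add_le_same_cancel1, intro mult_nonneg_nonpos) auto
  also have "expectation (\<lambda>z. exp (- \<eta> * ?X z)) = exp (- \<eta> * \<epsilon>) * ?m"
    by (simp add: exp_add[symmetric] algebra_simps flip: integral_mult_right_zero)
  also have "a / \<eta> * (1 - exp (- \<eta> * \<epsilon>) * ?m) \<le> a / \<eta> * (\<eta> * \<epsilon> - ln ?m)"
  proof (rule mult_left_mono)
    show "1 - exp (- \<eta> * \<epsilon>) * ?m \<le> \<eta> * \<epsilon> - ln ?m"
      using ln_le_minus_one[of "exp (- \<eta> * \<epsilon>) * ?m"] m by (simp add: ln_mult)
  qed (use \<open>1 \<le> a\<close> \<eta> in auto)
  finally have "c * expectation L \<le> a / \<eta> * (\<eta> * \<epsilon> - ln ?m)" .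
  then have "\<eta> / (a / c) * expectation L \<le> \<eta> * \<epsilon> - ln ?m"
    using \<open>1 \<le> a\<close> \<eta> \<open>0 < c\<close> by (simp add: field_simps)
  moreover have "witness_const c \<eta> w (u + \<epsilon>) = a / c"
    by (simp add: witness_const_def a_def)
  ultimately show "\<eta> / witness_const c \<eta> w (u + \<epsilon>) * expectation L - \<eta> * \<epsilon> \<le> - ln ?m"
    by simp
qed

section \<open>Extended-real expectations\<close>

lemma ereal_expectation_integrable:
  assumes "integrable M f"
  shows "ereal_expectation M (\<lambda>x. ereal (f x)) = ereal (integral\<^sup>L M f)"
proof -
  have *: "e2ennreal (max 0 (ereal y)) = ennreal y" for y
    by (simp add: max_def ennreal_neg flip: zero_ereal_def)
  have **: "enn2ereal y = ereal (enn2real y)" if "y \<noteq> \<infinity>" for y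
    using that by (cases y) (auto simp: enn2ereal_ennreal)
  have fin: "(\<integral>\<^sup>+ x. ennreal (f x) \<partial>M) \<noteq> \<infinity>" "(\<integral>\<^sup>+ x. ennreal (- f x) \<partial>M) \<noteq> \<infinity>"
    using assms unfolding real_integrable_def by auto
  show ?thesis
    unfolding ereal_expectation_def real_lebesgue_integral_def[OF assms] uminus_ereal.simps *
      **[OF fin(1)] **[OF fin(2)] by simp
qed

lemma ereal_expectation_cong_AE:
  assumes "AE x in M. X x = Y x"
  shows "ereal_expectation M X = ereal_expectation M Y"
  unfolding ereal_expectation_def
  using assms by (intro arg_cong2[where f="(-)"] arg_cong[where f=enn2ereal] nn_integral_cong_AE) auto

text \<open>By the convention \<infinity> - \<infinity> = \<infinity>, an infinite positive part
  makes the expectation \<infinity> whatever the negative part is.\<close>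

lemma positive_part_finite:
  assumes "ereal_expectation M X \<noteq> \<infinity>"
  shows "(\<integral>\<^sup>+ x. e2ennreal (max 0 (X x)) \<partial>M) < \<infinity>"
  using assms unfolding ereal_expectation_def by (auto simp: top.not_eq_extremum[symmetric])

section \<open>Change of measure from posterior to prior\<close>

text \<open>Weighting \<open>N\<close> by the inverse density recovers \<open>M\<close> only where
  the density is positive and finite; elsewhere \<open>g * inverse g\<close> is 0. The mass of
  \<open>M\<close> lost there makes this an inequality.\<close>

lemma nn_integral_RN_deriv_le:
  assumes "sigma_finite_measure M" "absolutely_continuous M N" "sets N = sets M"
    and [measurable]: "h \<in> borel_measurable M"
  shows "(\<integral>\<^sup>+ x. h x * inverse (RN_deriv M N x) \<partial>N) \<le> (\<integral>\<^sup>+ x. h x \<partial>M)"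
proof -
  interpret sigma_finite_measure M by fact
  have "(\<integral>\<^sup>+ x. h x * inverse (RN_deriv M N x) \<partial>N)
      = (\<integral>\<^sup>+ x. h x * inverse (RN_deriv M N x) \<partial>density M (RN_deriv M N))"
    using density_RN_deriv[OF assms(2,3)] by simp
  also have "\<dots> = (\<integral>\<^sup>+ x. RN_deriv M N x * (h x * inverse (RN_deriv M N x)) \<partial>M)"
    by (rule nn_integral_density) measurable
  also have "\<dots> \<le> (\<integral>\<^sup>+ x. h x \<partial>M)"
  proof (rule nn_integral_mono)
    fix x
    have "g * inverse g \<le> (1::ennreal)" for g
    proof (cases "g = 0 \<or> g = \<infinity>")
      case False
      then show ?thesis by (simp add: ennreal_divide_self top.not_eq_extremum flip: divide_ennreal_def)
    qed auto
    then have "h x * (RN_deriv M N x * inverse (RN_deriv M N x)) \<le> h x * 1"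
      by (intro mult_left_mono) auto
    then show "RN_deriv M N x * (h x * inverse (RN_deriv M N x)) \<le> h x"
      by (simp add: ac_simps)
  qed
  finally show ?thesis .
qed


lemma prob_space_exp_integral_le:
  assumes "prob_space N" "integrable N V" "integrable N (\<lambda>x. exp (V x :: real))"
  shows "exp (\<integral>x. V x \<partial>N) \<le> (\<integral>x. exp (V x) \<partial>N)"
  using prob_space.jensens_inequality[OF assms(1,2) _ _ assms(3) exp_convex] by simp

text \<open>Jensen's inequality under \<open>N\<close> for the exponent minus the log-density,
  followed by the change of measure to \<open>M\<close>. Integrability of each term has to be
  derived first, so that the extended-real quantities become real ones. Domination by
  \<open>h\<close> is asked only where \<open>S\<close> is finite, since \<open>S\<close> is finite
  \<open>N\<close>-almost everywhere unless \<open>U'\<close> is \<infinity>.\<close>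

lemma donsker_varadhan_esi_bound:
  fixes S :: "'f \<Rightarrow> ereal" and T :: "'f \<Rightarrow> real" and h :: "'f \<Rightarrow> ennreal"
  assumes M: "prob_space M" and N: "prob_space N" and sets: "sets N = sets M"
    and ac: "absolutely_continuous M N"
    and pos: "0 < b" "0 < C"
    and T[measurable]: "T \<in> borel_measurable M" and T0: "\<And>f. f \<in> space M \<Longrightarrow> 0 \<le> T f"
    and S[measurable]: "S \<in> borel_measurable M" and SM: "\<And>f. f \<in> space M \<Longrightarrow> S f \<noteq> -\<infinity>"
    and h[measurable]: "h \<in> borel_measurable M"
    and dom: "\<And>f. f \<in> space M \<Longrightarrow> S f \<noteq> \<infinity> \<Longrightarrow>
      ennreal (exp (b * (T f / C - real_of_ereal (S f) - e))) \<le> h f"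
  defines "U \<equiv> ereal_expectation N (\<lambda>f. ereal (T f))"
    and "U' \<equiv> ereal C * (ereal_expectation N S + KL N M / ereal b + ereal e)"
  shows "exp_ereal (ereal (b / C) * (if U' = \<infinity> then -\<infinity> else U - U')) \<le> (\<integral>\<^sup>+ f. h f \<partial>M)"
proof (cases "U' = \<infinity> \<or> (\<integral>\<^sup>+ f. h f \<partial>M) = \<infinity>")
  case True
  then show ?thesis
  proof
    assume "U' = \<infinity>"
    moreover have "0 < b / C" using pos by simp
    ultimately show ?thesis using pos by (simp add: exp_ereal_def)
  qed simp
next
  case False
  interpret M: prob_space M by fact
  interpret N: prob_space N by fact
  have space: "space N = space M" using sets by (rule sets_eq_imp_space_eq)
  note [measurable_cong] = sets
  define k where "k = entropy_density (exp 1) M N"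
  have [measurable]: "k \<in> borel_measurable N" by (simp add: k_def cong: measurable_cong_sets[OF sets refl])
  have kl: "KL N M = ereal_expectation N (\<lambda>f. ereal (k f))"
    using ac by (simp add: KL_def k_def)
  \<comment> \<open>In \<open>ereal\<close> a sum with a summand \<infinity> is \<infinity>, even if
    another summand is -\<infinity>, so \<open>U' \<noteq> \<infinity>\<close> excludes \<infinity>
    for both.\<close>
  have "ereal_expectation N S \<noteq> \<infinity>" "KL N M \<noteq> \<infinity>"
    using False pos by (auto simp: U'_def)
  note fin = this[unfolded kl, THEN positive_part_finite]
  have AE_S: "AE f in N. S f \<noteq> \<infinity>"
  proof -
    have "AE f in N. e2ennreal (max 0 (S f)) \<noteq> \<infinity>"
      using fin(1) by (intro nn_integral_noteq_infinite) auto
    then show ?thesis by eventually_elim (auto simp: max_def)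
  qed
  define s where "s f = real_of_ereal (S f)" for f
  have [measurable]: "s \<in> borel_measurable N" unfolding s_def by measurable
  have Ss: "AE f in N. S f = ereal (s f)"
    using AE_S AE_space by eventually_elim (use SM in \<open>auto simp: s_def space ereal_real\<close>)
  have pp: "e2ennreal (max 0 (ereal y)) = ennreal (max 0 y)" for y
    by (simp add: max_def flip: zero_ereal_def)
  have s_pos: "integrable N (\<lambda>f. max 0 (s f))"
  proof (rule integrableI_nonneg)
    have "(\<integral>\<^sup>+ f. ennreal (max 0 (s f)) \<partial>N) = (\<integral>\<^sup>+ f. e2ennreal (max 0 (S f)) \<partial>N)"
      using Ss by (intro nn_integral_cong_AE) (auto simp: pp elim!: eventually_mono)
    then show "(\<integral>\<^sup>+ f. ennreal (max 0 (s f)) \<partial>N) < \<infinity>" using fin(1) by simp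
  qed auto
  have k_pos: "integrable N (\<lambda>f. max 0 (k f))"
    using fin(2) by (intro integrableI_nonneg) (auto simp: pp)
  \<comment> \<open>\<open>N\<close>-almost everywhere the density is positive and finite; elsewhere
    \<open>k\<close> is only a default value of the logarithm.\<close>
  have AE_k: "AE f in N. ennreal (exp (- k f)) = inverse (RN_deriv M N f)"
  proof -
    have "AE f in N. RN_deriv M N f \<noteq> \<infinity>"
      using M.RN_deriv_finite[OF N.sigma_finite_measure_axioms ac sets] ac sets
      by (intro absolutely_continuous_AE[OF sets ac])
    moreover have "AE f in N. 0 < RN_deriv M N f"
    proof -
      have "AE f in density M (RN_deriv M N). 0 < RN_deriv M N f"
        by (subst AE_density) auto
      then show ?thesis unfolding M.density_RN_deriv[OF ac sets] .
    qed
    ultimately show ?thesis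
    proof eventually_elim
      case (elim f)
      then obtain r where "RN_deriv M N f = ennreal r" "0 < r"
        by (cases "RN_deriv M N f") auto
      then show ?case
        by (simp add: k_def entropy_density_def log_def exp_minus inverse_ennreal)
    qed
  qed
  \<comment> \<open>The inverse density has \<open>N\<close>-integral at most the total mass of
    \<open>M\<close>. As \<open>- k \<le> exp (- k)\<close>, this controls the negative part of
    \<open>k\<close>, and a divergence other than \<infinity> controls the positive part.\<close>
  have k_neg: "integrable N (\<lambda>f. exp (- k f))"
  proof (rule integrableI_nonneg)
    have "(\<integral>\<^sup>+ f. ennreal (exp (- k f)) \<partial>N) = (\<integral>\<^sup>+ f. 1 * inverse (RN_deriv M N f) \<partial>N)"
      using AE_k by (intro nn_integral_cong_AE) auto
    also have "\<dots> \<le> (\<integral>\<^sup>+ f. 1 \<partial>M)"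
      by (intro nn_integral_RN_deriv_le M.sigma_finite_measure_axioms ac sets) auto
    finally show "(\<integral>\<^sup>+ f. ennreal (exp (- k f)) \<partial>N) < \<infinity>"
      by (simp add: M.emeasure_space_1 le_less_trans)
  qed auto
  have k_int: "integrable N k"
  proof (rule Bochner_Integration.integrable_bound)
    show "integrable N (\<lambda>f. max 0 (k f) + exp (- k f))" using k_pos k_neg by auto
    have "norm (k f) \<le> norm (max 0 (k f) + exp (- k f))" for f
      using exp_ge_add_one_self[of "- k f"] exp_gt_zero[of "- k f"] by (simp add: max_def abs_if)
    then show "AE f in N. norm (k f) \<le> norm (max 0 (k f) + exp (- k f))" by (intro AE_I2)
  qed auto
  \<comment> \<open>The mean of \<open>V\<close> under \<open>N\<close> will be \<open>b / C\<close>
    times \<open>U - U'\<close>, while the term \<open>- k\<close> gives \<open>exp (V f)\<close>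
    the factor that turns integration over \<open>N\<close> into integration over
    \<open>M\<close>.\<close>
  define V where "V f = b * (T f / C - s f - e) - k f" for f
  have [measurable]: "V \<in> borel_measurable N" unfolding V_def by measurable
  have expV: "(\<integral>\<^sup>+ f. ennreal (exp (V f)) \<partial>N) \<le> (\<integral>\<^sup>+ f. h f \<partial>M)"
  proof -
    have "AE f in N. ennreal (exp (V f)) \<le> h f * inverse (RN_deriv M N f)"
      using AE_k AE_S AE_space
    proof eventually_elim
      case (elim f)
      have "ennreal (exp (V f)) = ennreal (exp (b * (T f / C - s f - e))) * ennreal (exp (- k f))"
        by (simp add: V_def exp_diff exp_minus divide_inverse flip: ennreal_mult)
      also have "\<dots> \<le> h f * inverse (RN_deriv M N f)"
        using dom[of f] elim space unfolding s_def by (intro mult_mono) auto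
      finally show ?case .
    qed
    then have "(\<integral>\<^sup>+ f. ennreal (exp (V f)) \<partial>N) \<le> (\<integral>\<^sup>+ f. h f * inverse (RN_deriv M N f) \<partial>N)"
      by (rule nn_integral_mono_AE)
    also have "\<dots> \<le> (\<integral>\<^sup>+ f. h f \<partial>M)"
      by (intro nn_integral_RN_deriv_le M.sigma_finite_measure_axioms ac sets) auto
    finally show ?thesis .
  qed
  have expV_int: "integrable N (\<lambda>f. exp (V f))"
    using expV False by (intro integrableI_nonneg) (auto simp: top.not_eq_extremum)
  \<comment> \<open>The finite exponential moment bounds \<open>V\<close> from above, which in turn bounds \<open>T\<close> and
    the negative part of \<open>s\<close>.\<close>
  define B where "B f = exp (V f) + b * max 0 (s f) + \<bar>k f\<bar> + b * \<bar>e\<bar>" for f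
  have B_int: "integrable N B" unfolding B_def using expV_int s_pos k_int by auto
  have bound: "b * (T f / C) + b * max 0 (- s f) \<le> B f" for f
  proof -
    have "b * (T f / C) + b * max 0 (- s f) = V f + b * max 0 (s f) + k f + b * e"
      by (auto simp: V_def max_def algebra_simps)
    also have "b * e \<le> b * \<bar>e\<bar>" using pos by (intro mult_left_mono) auto
    finally show ?thesis
      using exp_ge_add_one_self[of "V f"] unfolding B_def by linarith
  qed
  have T_int: "integrable N T"
  proof (rule Bochner_Integration.integrable_bound)
    show "integrable N (\<lambda>f. C / b * B f)" using B_int by auto
    show "AE f in N. norm (T f) \<le> norm (C / b * B f)"
    proof (rule AE_I2)
      fix f assume "f \<in> space N"
      have "b * (T f / C) \<le> B f"
        by (rule order_trans[OF _ bound[of f]]) (use pos in auto)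
      then have "T f \<le> C / b * B f" using pos by (simp add: field_simps)
      moreover have "0 \<le> T f" using T0[of f] \<open>f \<in> space N\<close> space by simp
      ultimately show "norm (T f) \<le> norm (C / b * B f)" unfolding real_norm_def by linarith
    qed
  qed auto
  have s_int: "integrable N s"
  proof (rule Bochner_Integration.integrable_bound)
    show "integrable N (\<lambda>f. max 0 (s f) + B f / b)" using B_int s_pos by auto
    show "AE f in N. norm (s f) \<le> norm (max 0 (s f) + B f / b)"
    proof (rule AE_I2)
      fix f assume "f \<in> space N"
      then have "0 \<le> b * (T f / C)" using T0[of f] space pos by simp
      then have "b * max 0 (- s f) \<le> B f" using bound[of f] by linarith
      then have "max 0 (- s f) \<le> B f / b"
        using pos by (simp only: pos_le_divide_eq mult.commute)
      then show "norm (s f) \<le> norm (max 0 (s f) + B f / b)" unfolding real_norm_def by linarith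
    qed
  qed auto
  have V_int: "integrable N V" unfolding V_def using T_int s_int k_int by auto
  have "U = ereal (\<integral>f. T f \<partial>N)" unfolding U_def by (rule ereal_expectation_integrable[OF T_int])
  moreover have "ereal_expectation N S = ereal (\<integral>f. s f \<partial>N)"
    using ereal_expectation_cong_AE[OF Ss] ereal_expectation_integrable[OF s_int] by simp
  then have "U' = ereal (C * ((\<integral>f. s f \<partial>N) + (\<integral>f. k f \<partial>N) / b + e))"
    unfolding U'_def kl ereal_expectation_integrable[OF k_int] using pos by simp
  moreover have "(\<integral>f. V f \<partial>N) = b / C * ((\<integral>f. T f \<partial>N) - C * ((\<integral>f. s f \<partial>N) + (\<integral>f. k f \<partial>N) / b + e))"
    unfolding V_def using T_int s_int k_int pos by (simp add: N.prob_space field_simps)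
  ultimately have "exp_ereal (ereal (b / C) * (if U' = \<infinity> then -\<infinity> else U - U')) = ennreal (exp (\<integral>f. V f \<partial>N))"
    by (simp add: exp_ereal_def)
  also have "\<dots> \<le> ennreal (\<integral>f. exp (V f) \<partial>N)"
    by (intro ennreal_leI prob_space_exp_integral_le N V_int expV_int)
  also have "\<dots> = (\<integral>\<^sup>+ f. ennreal (exp (V f)) \<partial>N)"
    using expV_int by (simp add: nn_integral_eq_integral)
  also have "\<dots> \<le> (\<integral>\<^sup>+ f. h f \<partial>M)" by (rule expV)
  finally show ?thesis .
qed

section \<open>Moments of the excess loss\<close>

lemma AE_finite_and_integrable_real_of_ereal:
  fixes X :: "'a \<Rightarrow> ereal"
  assumes [measurable]: "X \<in> borel_measurable M"
    and pos: "(\<integral>\<^sup>+ x. e2ennreal (max 0 (X x)) \<partial>M) < \<infinity>"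
    and neg: "(\<integral>\<^sup>+ x. e2ennreal (max 0 (- X x)) \<partial>M) < \<infinity>"
  shows "AE x in M. X x = ereal (real_of_ereal (X x))"
    and "integrable M (\<lambda>x. real_of_ereal (X x))"
proof -
  have "AE x in M. e2ennreal (max 0 (X x)) \<noteq> \<infinity>"
    using pos by (intro nn_integral_noteq_infinite) auto
  moreover have "AE x in M. e2ennreal (max 0 (- X x)) \<noteq> \<infinity>"
    using neg by (intro nn_integral_noteq_infinite) auto
  ultimately show "AE x in M. X x = ereal (real_of_ereal (X x))"
  proof eventually_elim
    case (elim x)
    then show ?case by (cases "X x") (auto simp: max_def)
  qed
  \<comment> \<open>\<open>real_of_ereal\<close> sends both infinities to 0, so these bounds hold
    for infinite y too.\<close>
  have "ennreal (real_of_ereal y) \<le> e2ennreal (max 0 y)"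
    and "ennreal (- real_of_ereal y) \<le> e2ennreal (max 0 (- y))" for y
    by (cases y; simp add: max_def ennreal_neg flip: zero_ereal_def)+
  then have "(\<integral>\<^sup>+ x. ennreal (real_of_ereal (X x)) \<partial>M) \<le> (\<integral>\<^sup>+ x. e2ennreal (max 0 (X x)) \<partial>M)"
    and "(\<integral>\<^sup>+ x. ennreal (- real_of_ereal (X x)) \<partial>M) \<le> (\<integral>\<^sup>+ x. e2ennreal (max 0 (- X x)) \<partial>M)"
    by (auto intro!: nn_integral_mono)
  then show "integrable M (\<lambda>x. real_of_ereal (X x))"
    using pos neg unfolding real_integrable_def by (auto simp: top_unique)
qed

lemma measurable_exp_ereal [measurable]: "exp_ereal \<in> borel_measurable borel"
  unfolding exp_ereal_def[abs_def] by measurable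

context learning_problem
begin

lemma loss_measurable_snd [measurable]: "f \<in> space F \<Longrightarrow> l f \<in> borel_measurable P"
  using measurable_Pair2[OF loss_measurable] by simp

lemma measurable_excess_loss [measurable]: "f \<in> space F \<Longrightarrow> excess_loss l fstar f \<in> borel_measurable P"
  unfolding excess_loss_def[abs_def] using fstar_in_model by measurable

lemma measurable_excess_loss_pair:
  "(\<lambda>x. excess_loss l fstar (fst x) (snd x)) \<in> borel_measurable (F \<Otimes>\<^sub>M P)"
proof -
  have [measurable]: "(\<lambda>x. l (fst x) (snd x)) \<in> borel_measurable (F \<Otimes>\<^sub>M P)"
    using loss_measurable by (simp add: case_prod_beta')
  show ?thesis
    unfolding excess_loss_def using fstar_in_model by measurable
qed

text \<open>The central condition is applied with \<open>f = fstar\<close>: where \<open>l fstar = \<infinity>\<close>, the exponent is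
  \<open>\<infinity> - \<infinity> = \<infinity>\<close>.\<close>

lemma comparator_AE_finite:
  assumes "central_up_to P F l fstar w \<epsilon>" "0 < w"
  shows "AE z in P. \<bar>l fstar z\<bar> \<noteq> \<infinity>"
proof -
  let ?g = "\<lambda>z. exp_ereal (ereal w * (l fstar z - l fstar z - ereal \<epsilon>))"
  have "(\<integral>\<^sup>+ z. ?g z \<partial>P) \<le> 1"
    using assms fstar_in_model by (auto simp: central_up_to_def)
  then have "AE z in P. ?g z \<noteq> \<infinity>"
    using fstar_in_model by (intro nn_integral_noteq_infinite) (auto simp: top_unique)
  with AE_space show ?thesis
  proof eventually_elim
    case (elim z)
    then show ?case
      using loss_not_MInf[OF fstar_in_model, of z] \<open>0 < w\<close>
      by (cases "l fstar z") (auto simp: exp_ereal_def)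
  qed
qed

text \<open>The central condition controls the negative part of the excess loss and the witness
  condition the positive part. Together they make it integrable, which permits passing to the
  real-valued \<open>L\<close>.\<close>

lemma excess_loss_moments:
  fixes f w \<epsilon> u c
  assumes central: "central_up_to P F l fstar w \<epsilon>" "0 < w" "0 \<le> \<epsilon>"
    and witness: "witness_condition P F l fstar u c"
    and f: "f \<in> space F"
  defines "L \<equiv> \<lambda>z. real_of_ereal (excess_loss l fstar f z)"
  shows "AE z in P. excess_loss l fstar f z = ereal (L z)"
    and "integrable P L"
    and "0 \<le> expectation L"
    and "integrable P (\<lambda>z. exp (- w * (L z + \<epsilon>)))"
    and "expectation (\<lambda>z. exp (- w * (L z + \<epsilon>))) \<le> 1"
    and "c * expectation L \<le> expectation (\<lambda>z. if L z \<le> u then L z else 0)"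
proof -
  define X where "X = excess_loss l fstar f"
  have [measurable]: "X \<in> borel_measurable P" using f by (simp add: X_def)
  note [measurable] = loss_measurable_snd[OF f] loss_measurable_snd[OF fstar_in_model]
  let ?e = "\<lambda>z. exp_ereal (ereal w * (l fstar z - l f z - ereal \<epsilon>))"
  have e: "(\<integral>\<^sup>+ z. ?e z \<partial>P) \<le> 1" using central f by (auto simp: central_up_to_def)
  have fin: "AE z in P. \<bar>l fstar z\<bar> \<noteq> \<infinity> \<and> l f z \<noteq> -\<infinity>"
    using comparator_AE_finite[OF central(1,2)] AE_space
    by eventually_elim (use loss_not_MInf f in auto)
  have e_eq: "?e z = (if X z = \<infinity> then 0 else ennreal (exp (- w * (real_of_ereal (X z) + \<epsilon>)))) \<and> X z \<noteq> -\<infinity>"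
    if "\<bar>l fstar z\<bar> \<noteq> \<infinity> \<and> l f z \<noteq> -\<infinity>" for z
    using that \<open>0 < w\<close> by (cases "l fstar z"; cases "l f z") (auto simp: X_def excess_loss_def exp_ereal_def algebra_simps)
  \<comment> \<open>The negative part is dominated by the exponential moment through
    \<open>1 + t \<le> exp t\<close> at \<open>t = - w * (y + \<epsilon>)\<close>.\<close>
  have "(\<integral>\<^sup>+ z. e2ennreal (max 0 (- X z)) \<partial>P) \<le> (\<integral>\<^sup>+ z. ennreal (1 / w) * (?e z + ennreal (w * \<epsilon>)) \<partial>P)"
  proof (rule nn_integral_mono_AE, rule AE_mp[OF fin], rule AE_I2, rule impI)
    fix z assume z: "\<bar>l fstar z\<bar> \<noteq> \<infinity> \<and> l f z \<noteq> -\<infinity>"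
    have "max 0 (- y) \<le> 1 / w * (exp (- w * (y + \<epsilon>)) + w * \<epsilon>)" for y
      using exp_ge_add_one_self[of "- w * (y + \<epsilon>)"] central
      by (auto simp: max_def field_simps)
    then have "ennreal (max 0 (- y)) \<le> ennreal (1 / w * (exp (- w * (y + \<epsilon>)) + w * \<epsilon>))" for y
      by (rule ennreal_leI)
    then have *: "ennreal (max 0 (- y)) \<le> ennreal (1 / w) * (ennreal (exp (- w * (y + \<epsilon>))) + ennreal (w * \<epsilon>))" for y
      using central by (simp only: ennreal_mult ennreal_plus exp_ge_zero add_nonneg_nonneg mult_nonneg_nonneg less_imp_le zero_le_divide_1_iff)
    show "e2ennreal (max 0 (- X z)) \<le> ennreal (1 / w) * (?e z + ennreal (w * \<epsilon>))"
      using e_eq[OF z] *[of "real_of_ereal (X z)"]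
      by (cases "X z") (auto simp: max_def simp flip: zero_ereal_def)
  qed
  also have "\<dots> = ennreal (1 / w) * ((\<integral>\<^sup>+ z. ?e z \<partial>P) + ennreal (w * \<epsilon>))"
    by (subst nn_integral_cmult) (auto simp: nn_integral_add emeasure_space_1)
  also have "\<dots> < \<infinity>"
    using e by (auto simp: ennreal_mult_less_top le_less_trans[OF e])
  finally have neg: "(\<integral>\<^sup>+ z. e2ennreal (max 0 (- X z)) \<partial>P) < \<infinity>" .
  have c: "0 < u" "0 < c" and wit: "ereal c * ereal_expectation P X
      \<le> ereal_expectation P (\<lambda>z. if X z \<le> ereal u then X z else 0)"
    using witness f unfolding witness_condition_def X_def by auto
  \<comment> \<open>The truncated variable is at most \<open>u\<close>, so its expectation is not
    \<infinity>; the witness condition with \<open>0 < c\<close> passes this on to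
    \<open>X\<close>.\<close>
  have "ereal_expectation P (\<lambda>z. if X z \<le> ereal u then X z else 0) \<noteq> \<infinity>"
  proof -
    have "(\<integral>\<^sup>+ z. e2ennreal (max 0 (if X z \<le> ereal u then X z else 0)) \<partial>P) \<le> (\<integral>\<^sup>+ z. ennreal u \<partial>P)"
    proof (intro nn_integral_mono)
      fix z
      have "max 0 (if X z \<le> ereal u then X z else 0) \<le> ereal u" using c by auto
      then show "e2ennreal (max 0 (if X z \<le> ereal u then X z else 0)) \<le> ennreal u"
        using e2ennreal_mono by fastforce
    qed
    also have "\<dots> < \<infinity>" by (simp add: emeasure_space_1)
    finally show ?thesis
      unfolding ereal_expectation_def by (auto simp: ereal_minus_eq_PInfty_iff)
  qed
  then have "ereal_expectation P X \<noteq> \<infinity>" using wit c by auto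
  note pos = positive_part_finite[OF this]
  have L_X: "L = (\<lambda>z. real_of_ereal (X z))" by (simp add: L_def X_def)
  show L: "AE z in P. excess_loss l fstar f z = ereal (L z)" "integrable P L"
    using AE_finite_and_integrable_real_of_ereal[OF \<open>X \<in> borel_measurable P\<close> pos neg]
    by (simp_all add: L_X flip: X_def)
  then have [measurable]: "L \<in> borel_measurable P" by auto
  have EX: "ereal_expectation P X = ereal (expectation L)"
    using ereal_expectation_cong_AE[of X "\<lambda>z. ereal (L z)"] L ereal_expectation_integrable[of P L]
    by (simp add: X_def)
  show "0 \<le> expectation L" using fstar_optimal[OF f] EX by (simp add: X_def)
  have iY: "integrable P (\<lambda>z. if L z \<le> u then L z else 0)"
    by (rule Bochner_Integration.integrable_bound[OF L(2)]) auto
  have "ereal_expectation P (\<lambda>z. if X z \<le> ereal u then X z else 0)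
      = ereal_expectation P (\<lambda>z. ereal (if L z \<le> u then L z else 0))"
    using L(1) by (intro ereal_expectation_cong_AE) (auto simp: X_def zero_ereal_def elim!: eventually_mono)
  then show "c * expectation L \<le> expectation (\<lambda>z. if L z \<le> u then L z else 0)"
    using wit ereal_expectation_integrable[OF iY] EX by simp
  have eL: "(\<integral>\<^sup>+ z. ennreal (exp (- w * (L z + \<epsilon>))) \<partial>P) = (\<integral>\<^sup>+ z. ?e z \<partial>P)"
  proof (rule nn_integral_cong_AE)
    show "AE z in P. ennreal (exp (- w * (L z + \<epsilon>))) = ?e z"
      using L(1) fin
    proof eventually_elim
      case (elim z)
      then show ?case using e_eq[of z] by (auto simp: X_def L_def)
    qed
  qed
  show int: "integrable P (\<lambda>z. exp (- w * (L z + \<epsilon>)))"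
    using le_less_trans[OF e ennreal_one_less_top] by (intro integrableI_nonneg) (simp_all only: eL, auto)
  show "expectation (\<lambda>z. exp (- w * (L z + \<epsilon>))) \<le> 1"
    using e unfolding eL[symmetric] by (subst (asm) nn_integral_eq_integral[OF int]) auto
qed

end

section \<open>From one predictor to the i.i.d. sample\<close>

lemma (in product_sigma_finite) nn_integral_PiM_real_prod:
  fixes f :: "'i \<Rightarrow> 'a \<Rightarrow> real"
  assumes "finite I" "\<And>i. i \<in> I \<Longrightarrow> f i \<in> borel_measurable (M i)" "\<And>i x. i \<in> I \<Longrightarrow> 0 \<le> f i x"
  shows "(\<integral>\<^sup>+ x. ennreal (\<Prod>i\<in>I. f i (x i)) \<partial>Pi\<^sub>M I M) = (\<Prod>i\<in>I. \<integral>\<^sup>+ x. ennreal (f i x) \<partial>M i)"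
  using product_nn_integral_prod[of I "\<lambda>i x. ennreal (f i x)"] assms by (simp add: prod_ennreal)

theorem theorem22:
  fixes P :: "'z measure" and F :: "'f measure" and l :: "'f \<Rightarrow> 'z \<Rightarrow> ereal" and fstar :: 'f
    and Q :: "'z list \<Rightarrow> 'f measure" and v :: "real \<Rightarrow> real" and u c \<epsilon> \<eta> :: real and n :: nat
  assumes "learning_problem P F l fstar"
    and "learning_algorithm P F l Q"
    and "witness_condition P F l fstar u c"
    and "v_central P F l v"
    and "0 \<le> \<epsilon>" and "0 < \<eta>" and "\<eta> < v \<epsilon>"
    and "central_up_to P F l fstar (v \<epsilon>) \<epsilon>"
    and "1 \<le> n"
  shows "esi (Pi\<^sub>M {..<n} (\<lambda>_. P))
     (\<eta> * real n / witness_const c \<eta> (v \<epsilon>) (u + \<epsilon>))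
     (\<lambda>z. ereal_expectation (Q (sample n z)) (\<lambda>f. ereal_expectation P (excess_loss l fstar f)))
     (\<lambda>z. ereal (witness_const c \<eta> (v \<epsilon>) (u + \<epsilon>)) *
            (information_complexity l fstar Q n \<eta> z + ereal \<epsilon>))"
proof -
  interpret learning_problem P F l fstar by fact
  interpret Pn: product_sigma_finite "\<lambda>_. P" by unfold_locales
  interpret PM: prob_space "Pi\<^sub>M {..<n} (\<lambda>_. P)" by (intro prob_space_PiM prob_space_axioms)
  let ?Pn = "Pi\<^sub>M {..<n} (\<lambda>_. P)"
  define C where "C = witness_const c \<eta> (v \<epsilon>) (u + \<epsilon>)"
  have uc: "0 < u" "0 < c" using assms(3) by (auto simp: witness_condition_def)
  have C: "0 < C"
    using assms(5-7) uc by (auto simp: C_def witness_const_def field_simps intro!: add_nonneg_pos)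
  define L where "L f z = real_of_ereal (excess_loss l fstar f z)" for f z
  have "0 < v \<epsilon>" using assms by simp
  note moments = excess_loss_moments[OF assms(8) this assms(5,3), folded L_def]
  have Lpair: "(\<lambda>x. L (fst x) (snd x)) \<in> borel_measurable (F \<Otimes>\<^sub>M P)"
    unfolding L_def using measurable_excess_loss_pair by measurable
  define m where "m f = expectation (\<lambda>z. exp (- \<eta> * L f z))" for f
  have ann: "integrable P (\<lambda>z. exp (- \<eta> * L f z))" "0 < m f"
    "\<eta> / C * expectation (L f) - \<eta> * \<epsilon> \<le> - ln (m f)" if "f \<in> space F" for f
    using witness_annealed_bound[OF assms(6,7,5) uc moments(2,4,5,6)] that
    unfolding m_def C_def by auto
  define T where "T f = expectation (L f)" for f
  have T_meas: "T \<in> borel_measurable F"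
    unfolding T_def using Lpair by (intro borel_measurable_lebesgue_integral) (simp add: case_prod_beta')
  have m_meas: "m \<in> borel_measurable F"
    unfolding m_def using Lpair by (intro borel_measurable_lebesgue_integral) (simp add: case_prod_beta')
  \<comment> \<open>Dividing each factor by its mean \<open>m f\<close> makes \<open>h f\<close>
    integrate to 1 over the sample, for every \<open>f\<close>.\<close>
  define h where "h f z = ennreal (\<Prod>i<n. exp (- \<eta> * L f (z i)) / m f)" for f and z :: "nat \<Rightarrow> 'z"
  define \<Pi>0 where "\<Pi>0 = Q []"
  have Q: "prob_space (Q zs)" "sets (Q zs) = sets F" "absolutely_continuous \<Pi>0 (Q zs)"
    if zs: "zs \<in> lists (space P)" for zs
  proof -
    have Q: "prob_space (Q zs) \<and> sets (Q zs) = sets F \<and> (\<exists>g\<in>borel_measurable F. Q zs = density (Q []) g)"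
      if "zs \<in> lists (space P)" for zs
      using assms(2) that unfolding learning_algorithm_def by blast
    show "prob_space (Q zs)" "sets (Q zs) = sets F"
      using Q[OF zs] by blast+
    obtain g where g: "g \<in> borel_measurable F" "Q zs = density \<Pi>0 g"
      using Q[OF zs] unfolding \<Pi>0_def by blast
    have "sets \<Pi>0 = sets F" using Q[of "[]"] unfolding \<Pi>0_def by simp
    from measurable_cong_sets[OF this refl] have "g \<in> borel_measurable \<Pi>0" using g(1) by blast
    then show "absolutely_continuous \<Pi>0 (Q zs)"
      unfolding g(2) by (rule absolutely_continuousI_density)
  qed
  interpret \<Pi>0: prob_space \<Pi>0 unfolding \<Pi>0_def by (rule Q) simp
  have sets0: "sets \<Pi>0 = sets F" unfolding \<Pi>0_def by (rule Q) simp
  have space0: "space \<Pi>0 = space F" using sets0 by (rule sets_eq_imp_space_eq)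
  note [measurable_cong] = sets0
  note [measurable] = T_meas m_meas
  have h_meas: "(\<lambda>x. h (fst x) (snd x)) \<in> borel_measurable (\<Pi>0 \<Otimes>\<^sub>M ?Pn)"
  proof -
    have "(\<lambda>x. L (fst x) (snd x i)) \<in> borel_measurable (\<Pi>0 \<Otimes>\<^sub>M ?Pn)" if "i < n" for i
      using measurable_compose[OF _ Lpair, of "\<lambda>x. (fst x, snd x i)" "\<Pi>0 \<Otimes>\<^sub>M ?Pn"] that by simp
    then show ?thesis unfolding h_def by measurable
  qed
  have h_int: "(\<integral>\<^sup>+ z. h f z \<partial>?Pn) = 1" if f: "f \<in> space F" for f
  proof -
    have [measurable]: "L f \<in> borel_measurable P" using moments(2)[OF f] by auto
    have "(\<integral>\<^sup>+ z. h f z \<partial>?Pn) = (\<Prod>i<n. \<integral>\<^sup>+ z. ennreal (exp (- \<eta> * L f z) / m f) \<partial>P)"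
      unfolding h_def using ann(2)[OF f] by (intro Pn.nn_integral_PiM_real_prod) auto
    also have "(\<integral>\<^sup>+ z. ennreal (exp (- \<eta> * L f z) / m f) \<partial>P) = ennreal (\<integral>z. exp (- \<eta> * L f z) / m f \<partial>P)"
      using ann[OF f] by (intro nn_integral_eq_integral) auto
    also have "(\<integral>z. exp (- \<eta> * L f z) / m f \<partial>P) = 1"
      using ann(2)[OF f] by (simp add: m_def)
    finally show ?thesis by simp
  qed
  \<comment> \<open>At a sample point with infinite \<open>l fstar\<close> an excess loss could be
    -\<infinity>. Such samples form a null set.\<close>
  have AE_fin: "AE z in ?Pn. \<forall>i<n. \<bar>l fstar (z i)\<bar> \<noteq> \<infinity>"
  proof -
    have "AE z in ?Pn. \<bar>l fstar (z i)\<bar> \<noteq> \<infinity>" if "i < n" for i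
      using that comparator_AE_finite[OF assms(8) \<open>0 < v \<epsilon>\<close>] prob_space_axioms
      by (intro AE_PiM_component) auto
    then have "AE z in ?Pn. \<forall>i\<in>{..<n}. \<bar>l fstar (z i)\<bar> \<noteq> \<infinity>"
      by (intro AE_finite_allI) auto
    then show ?thesis by (simp add: lessThan_iff Ball_def)
  qed
  have bound: "exp_ereal (ereal (\<eta> * real n / C) * (if U' z = \<infinity> then -\<infinity> else U z - U' z)) \<le> (\<integral>\<^sup>+ f. h f z \<partial>\<Pi>0)"
    if z: "z \<in> space ?Pn" and fin: "\<forall>i<n. \<bar>l fstar (z i)\<bar> \<noteq> \<infinity>"
      and U: "U = (\<lambda>z. ereal_expectation (Q (sample n z)) (\<lambda>f. ereal_expectation P (excess_loss l fstar f)))"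
      and U': "U' = (\<lambda>z. ereal C * (information_complexity l fstar Q n \<eta> z + ereal \<epsilon>))"
    for z U U'
  proof -
    define S where "S f = (\<Sum>i<n. excess_loss l fstar f (z i)) / ereal (real n)" for f
    have zi: "z i \<in> space P" if "i < n" for i using z that by (auto simp: space_PiM PiE_def Pi_def)
    have "sample n z \<in> lists (space P)" using zi by (auto simp: sample_def)
    note Qn = Q[OF this]
    have spaceQ: "space (Q (sample n z)) = space F" using Qn(2) by (rule sets_eq_imp_space_eq)
    have "ereal_expectation P (excess_loss l fstar f) = ereal (T f)" if "f \<in> space F" for f
      using ereal_expectation_cong_AE[OF moments(1)[OF that]] ereal_expectation_integrable[OF moments(2)[OF that]]
      by (simp add: T_def)
    then have U_eq: "U z = ereal_expectation (Q (sample n z)) (\<lambda>f. ereal (T f))"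
      unfolding U by (intro ereal_expectation_cong_AE AE_I2) (simp add: spaceQ)
    have not_MInf: "excess_loss l fstar f (z i) \<noteq> -\<infinity>" if "i < n" "f \<in> space F" for i f
      using fin zi[OF that(1)] loss_not_MInf[OF that(2), of "z i"] that
      by (cases "l f (z i)"; cases "l fstar (z i)") (auto simp: excess_loss_def)
    have ex_meas: "(\<lambda>f. excess_loss l fstar f (z i)) \<in> borel_measurable \<Pi>0" if "i < n" for i
      using measurable_compose[OF _ measurable_excess_loss_pair, of "\<lambda>f. (f, z i)" \<Pi>0] zi[OF that] by simp
    have S_meas: "S \<in> borel_measurable \<Pi>0"
      unfolding S_def using ex_meas by measurable
    have h_meas_z: "(\<lambda>f. h f z) \<in> borel_measurable \<Pi>0"
      using measurable_compose[OF _ h_meas, of "\<lambda>f. (f, z)" \<Pi>0] z by simp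
    \<comment> \<open>As no excess loss at the sample points is -\<infinity>, the average is
      \<infinity> if one of them is \<infinity>, and a real average otherwise.
      \<open>1 \<le> n\<close> keeps the divisor positive.\<close>
    have S_cases: "S f \<noteq> -\<infinity> \<and> (S f \<noteq> \<infinity> \<longrightarrow> real_of_ereal (S f) = (\<Sum>i<n. L f (z i)) / real n)"
      if f: "f \<in> space F" for f
    proof (cases "\<exists>i<n. excess_loss l fstar f (z i) = \<infinity>")
      case True
      then have "(\<Sum>i<n. excess_loss l fstar f (z i)) = \<infinity>" by (auto simp: sum_Pinfty)
      then show ?thesis using assms(9) by (simp add: S_def)
    next
      case False
      then have "excess_loss l fstar f (z i) = ereal (L f (z i))" if "i < n" for i
        using not_MInf[OF that f] that unfolding L_def by (cases "excess_loss l fstar f (z i)") auto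
      then have "(\<Sum>i<n. excess_loss l fstar f (z i)) = ereal (\<Sum>i<n. L f (z i))"
        by (simp flip: sum_ereal)
      then show ?thesis using assms(9) by (simp add: S_def)
    qed
    \<comment> \<open>This is n times the single-predictor bound; \<open>- ln (m f)\<close>, once
      per observation, supplies the denominators of \<open>h\<close>.\<close>
    have dom: "ennreal (exp ((\<eta> * real n) * (T f / C - real_of_ereal (S f) - \<epsilon>))) \<le> h f z"
      if f: "f \<in> space F" and "S f \<noteq> \<infinity>" for f
    proof -
      have "(\<eta> * real n) * (T f / C - real_of_ereal (S f) - \<epsilon>)
          = real n * (\<eta> / C * T f - \<eta> * \<epsilon>) - \<eta> * (\<Sum>i<n. L f (z i))"
        using S_cases[OF f] that(2) assms(9) by (simp add: field_simps)
      also have "\<dots> \<le> real n * (- ln (m f)) - \<eta> * (\<Sum>i<n. L f (z i))"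
        using ann(3)[OF f] by (intro diff_right_mono mult_left_mono) (auto simp: T_def)
      also have "\<dots> = (\<Sum>i<n. - \<eta> * L f (z i) - ln (m f))"
        by (simp add: sum_subtractf sum_distrib_left sum_negf)
      finally have "exp ((\<eta> * real n) * (T f / C - real_of_ereal (S f) - \<epsilon>))
          \<le> exp (\<Sum>i<n. - \<eta> * L f (z i) - ln (m f))" by simp
      also have "\<dots> = (\<Prod>i<n. exp (- \<eta> * L f (z i)) / m f)"
        using ann(2)[OF f] by (simp add: exp_sum exp_diff)
      finally show ?thesis unfolding h_def by (rule ennreal_leI)
    qed
    \<comment> \<open>The change of measure is applied with \<open>b = \<eta> * real n\<close>, the
      divisor of the divergence in the information complexity. Nonnegativity of \<open>T\<close>
      comes from the optimality of \<open>fstar\<close>.\<close>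
    have "0 < \<eta> * real n" using assms(6,9) by simp
    have "U' z = ereal C * (ereal_expectation (Q (sample n z)) S
        + KL (Q (sample n z)) \<Pi>0 / ereal (\<eta> * real n) + ereal \<epsilon>)"
      unfolding U' information_complexity_def S_def[abs_def] \<Pi>0_def ..
    then show ?thesis
      unfolding U_eq
      using donsker_varadhan_esi_bound[where T = T, OF \<Pi>0.prob_space_axioms Qn(1) Qn(2)[folded sets0] Qn(3)
          \<open>0 < \<eta> * real n\<close> C _ _ S_meas _ h_meas_z dom] S_cases moments(3)
      by (simp only: space0 T_def[symmetric]) (simp add: T_meas cong: measurable_cong_sets[OF sets0 refl])
  qed
  \<comment> \<open>The data-dependent posterior has been replaced by the prior, which does not vary
    with the sample, so the two integrals may be exchanged.\<close>
  have "(\<integral>\<^sup>+ z. (\<integral>\<^sup>+ f. h f z \<partial>\<Pi>0) \<partial>?Pn) = (\<integral>\<^sup>+ f. (\<integral>\<^sup>+ z. h f z \<partial>?Pn) \<partial>\<Pi>0)"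
  proof -
    interpret pair_sigma_finite \<Pi>0 ?Pn by unfold_locales
    show ?thesis using h_meas by (intro Fubini') (simp add: case_prod_beta')
  qed
  also have "\<dots> = (\<integral>\<^sup>+ f. 1 \<partial>\<Pi>0)"
    using h_int by (intro nn_integral_cong) (simp add: space0)
  finally have "(\<integral>\<^sup>+ z. (\<integral>\<^sup>+ f. h f z \<partial>\<Pi>0) \<partial>?Pn) = 1" by (simp add: \<Pi>0.emeasure_space_1)
  moreover have "(\<integral>\<^sup>+ z. exp_ereal (ereal (\<eta> * real n / C) * (if U' z = \<infinity> then -\<infinity> else U z - U' z)) \<partial>?Pn)
      \<le> (\<integral>\<^sup>+ z. (\<integral>\<^sup>+ f. h f z \<partial>\<Pi>0) \<partial>?Pn)"
    if "U = (\<lambda>z. ereal_expectation (Q (sample n z)) (\<lambda>f. ereal_expectation P (excess_loss l fstar f)))"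
      and "U' = (\<lambda>z. ereal C * (information_complexity l fstar Q n \<eta> z + ereal \<epsilon>))" for U U'
    \<comment> \<open>The left integrand need not be measurable, but the pointwise bound by a measurable
      function suffices, since the left-hand side is a lower integral.\<close>
    by (rule nn_integral_mono_AE) (use AE_fin AE_space in eventually_elim, rule bound[OF _ _ that])
  ultimately show ?thesis unfolding esi_def C_def[symmetric] by simp
qed

end
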